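(* Let $H$ be a separable Hilbert space, $(X,\mu)$ a measure space, $m>1$, and let $(F_i(x),v_i(x))_{x\in X,\, i\in[m]}$ be c-fusion woven for $H$ with universal bounds $A$ and $B$. If there exist $0<D<A$, a measurable subset $Y\subset X$ and $n\in[m]$ such that $$\sum_{i\in[m]\setminus\{n\}}\int_{X\setminus Y}v_i^2(x)\Vert\pi_{F_i(x)}h\Vert^2\,d\mu(x)\leq D\Vert h\Vert^2\qquad\text{for all } h\in H,$$ then the family $(F_i(x),v_i(x))_{x\in Y,\, i\in[m]}$ is c-fusion woven for $H$ with universal frame bounds $A-D$ and $B$.
   Context: $(X,\mu)$ is a measure space with positive measure $\mu$; $H$ is a complex Hilbert space; $\pi_V$ is the orthogonal projection of $H$ onto a closed subspace $V$; $[m]=\{1,\dots,m\}$ for $m>1$. c-fusion frame: a pair $(F,v)$, where $F$ maps $X$ to the closed subspaces of $H$ with $x\mapsto\pi_{F(x)}h$ weakly measurable for each $h\in H$ and $v:X\to\mathbb{R}^+$ is measurable, is a c-fusion frame for $H$ if there are $0<A\le B<\infty$ with $A\Vert h\Vert^2\le\int_X v^2(x)\Vert\pi_{F(x)}h\Vert^2\,d\mu\le B\Vert h\Vert^2$ for all $h\in H$. A partition of a measure space means a partition into pairwise disjoint measurable sets. A family of c-fusion frames $(F_i,v_i)_{i\in[m]}$ for $H$ is c-fusion woven for $H$ with universal bounds $0<A\le B$ if for every partition $\{\sigma_i\}_{i\in[m]}$ of $X$ the family $(F_i(x),v_i(x))_{i\in[m],x\in\sigma_i}$ is a c-fusion frame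 for $H$ with bounds $A,B$, i.e. $A\Vert h\Vert^2\le\sum_{i\in[m]}\int_{\sigma_i}v_i^2(x)\Vert\pi_{F_i(x)}h\Vert^2\,d\mu\le B\Vert h\Vert^2$ for all $h\in H$. For measurable $Y\subset X$, the family indexed by $x\in Y$ is c-fusion woven if this definition holds with $X$ replaced by the measure space $Y$ with the restricted measure. *)

theory Defs
  imports "HOL-Analysis.Analysis"
begin

text \<open>
  Complex Hilbert spaces. The inner product is linear in the first argument; the axiom
  \<open>cinner_self\<close> says both that it is positive definite and that it induces the norm.
\<close>

class chilbert_space = banach +
  fixes scaleC :: "complex \<Rightarrow> 'a \<Rightarrow> 'a"  (infixr "*\<^sub>C" 75)
    and cinner :: "'a \<Rightarrow> 'a \<Rightarrow> complex"
  assumes scaleC_add_right: "c *\<^sub>C (x + y) = c *\<^sub>C x + c *\<^sub>C y"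
    and scaleC_add_left: "(c + d) *\<^sub>C x = c *\<^sub>C x + d *\<^sub>C x"
    and scaleC_scaleC: "c *\<^sub>C d *\<^sub>C x = (c * d) *\<^sub>C x"
    and scaleR_scaleC: "r *\<^sub>R x = complex_of_real r *\<^sub>C x"
    and cinner_commute: "cinner x y = cnj (cinner y x)"
    and cinner_add_left: "cinner (x + y) z = cinner x z + cinner y z"
    and cinner_scaleC_left: "cinner (c *\<^sub>C x) y = c * cinner x y"
    and cinner_self: "cinner x x = complex_of_real ((norm x)\<^sup>2)"

interpretation complex_vector:
  vector_space "scaleC :: complex \<Rightarrow> 'a \<Rightarrow> 'a::chilbert_space"
proof
  fix x :: 'a
  show "1 *\<^sub>C x = x"
    using scaleR_scaleC[of 1 x] by simp
qed (simp_all add: scaleC_add_right scaleC_add_left scaleC_scaleC)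

definition orth_proj :: "'h::chilbert_space set \<Rightarrow> 'h \<Rightarrow> 'h" where
  "orth_proj V h = (THE p. p \<in> V \<and> (\<forall>u\<in>V. cinner (h - p) u = 0))"

definition weakly_measurable :: "'x measure \<Rightarrow> ('x \<Rightarrow> 'h::chilbert_space) \<Rightarrow> bool" where
  "weakly_measurable M f \<longleftrightarrow> (\<forall>g. (\<lambda>x. cinner (f x) g) \<in> borel_measurable M)"

text \<open>
  The measure space is \<open>M\<close>, and only values at points of \<open>space M\<close> matter. All integrands are
  nonnegative, so integrals are taken in \<^typ>\<open>ennreal\<close>; a finite upper bound is then a genuine
  finiteness statement.
\<close>

definition c_fusion_frame ::
    "'x measure \<Rightarrow> ('x \<Rightarrow> 'h::chilbert_space set) \<Rightarrow> ('x \<Rightarrow> real) \<Rightarrow> bool" where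
  "c_fusion_frame M F v \<longleftrightarrow>
     (\<forall>x\<in>space M. closed (F x) \<and> complex_vector.subspace (F x)) \<and>
     (\<forall>h. weakly_measurable M (\<lambda>x. orth_proj (F x) h)) \<and>
     v \<in> borel_measurable M \<and> (\<forall>x\<in>space M. 0 < v x) \<and>
     (\<exists>A B. 0 < A \<and> A \<le> B \<and>
       (\<forall>h. ennreal (A * (norm h)\<^sup>2)
              \<le> (\<integral>\<^sup>+x. ennreal ((v x)\<^sup>2 * (norm (orth_proj (F x) h))\<^sup>2) \<partial>M) \<and>
            (\<integral>\<^sup>+x. ennreal ((v x)\<^sup>2 * (norm (orth_proj (F x) h))\<^sup>2) \<partial>M)
              \<le> ennreal (B * (norm h)\<^sup>2)))"

text \<open>Blocks of a partition are indexed by \<open>{1..m}\<close> and may be empty.\<close>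

definition measurable_partition :: "'x measure \<Rightarrow> nat \<Rightarrow> (nat \<Rightarrow> 'x set) \<Rightarrow> bool" where
  "measurable_partition M m \<sigma> \<longleftrightarrow>
     (\<forall>i\<in>{1..m}. \<sigma> i \<in> sets M) \<and> disjoint_family_on \<sigma> {1..m} \<and>
     (\<Union>i\<in>{1..m}. \<sigma> i) = space M"

definition c_fusion_woven ::
    "'x measure \<Rightarrow> nat \<Rightarrow> (nat \<Rightarrow> 'x \<Rightarrow> 'h::chilbert_space set) \<Rightarrow> (nat \<Rightarrow> 'x \<Rightarrow> real)
      \<Rightarrow> real \<Rightarrow> real \<Rightarrow> bool" where
  "c_fusion_woven M m F v A B \<longleftrightarrow>
     0 < A \<and> A \<le> B \<and>
     (\<forall>i\<in>{1..m}. c_fusion_frame M (F i) (v i)) \<and>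
     (\<forall>\<sigma>. measurable_partition M m \<sigma> \<longrightarrow>
       (\<forall>h. ennreal (A * (norm h)\<^sup>2)
              \<le> (\<Sum>i\<in>{1..m}. \<integral>\<^sup>+x\<in>\<sigma> i. ennreal ((v i x)\<^sup>2 * (norm (orth_proj (F i x) h))\<^sup>2) \<partial>M) \<and>
            (\<Sum>i\<in>{1..m}. \<integral>\<^sup>+x\<in>\<sigma> i. ennreal ((v i x)\<^sup>2 * (norm (orth_proj (F i x) h))\<^sup>2) \<partial>M)
              \<le> ennreal (B * (norm h)\<^sup>2)))"

end

theory Submission
  imports Defs
begin

text \<open>Given a partition of \<open>Y\<close>, add \<open>X - Y\<close> to a block whose index differs from \<open>n\<close>; such an
  index exists since \<open>m > 1\<close>. The result is a partition of \<open>X\<close>, and the added part contributes at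
  most \<open>D * (norm h)\<^sup>2\<close> to the weaving, so the given partition of \<open>Y\<close> retains \<open>A - D\<close>. The partition
  with \<open>Y\<close> as its only nonempty block shows that each restricted family is itself a c-fusion frame.\<close>

text \<open>\<open>f\<close> need not be measurable: the integral is a supremum over simple functions, and it is those
  that are split along \<open>S\<close> and \<open>T\<close>. This avoids showing that the norms of the projections are
  measurable.\<close>

lemma set_nn_integral_Un_le:
  assumes S: "S \<in> sets M" and T: "T \<in> sets M"
  shows "(\<integral>\<^sup>+x\<in>S \<union> T. f x \<partial>M) \<le> (\<integral>\<^sup>+x\<in>S. f x \<partial>M) + (\<integral>\<^sup>+x\<in>T. f x \<partial>M)"
  unfolding nn_integral_def[of M "\<lambda>x. f x * indicator (S \<union> T) x"]
proof (rule SUP_least)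
  fix g assume "g \<in> {g. simple_function M g \<and> g \<le> (\<lambda>x. f x * indicator (S \<union> T) x)}"
  then have g: "simple_function M g" and le: "\<And>x. g x \<le> f x * indicator (S \<union> T) x"
    by (auto simp: le_fun_def)
  have [measurable]: "g \<in> borel_measurable M" "S \<in> sets M" "T \<in> sets M"
    using g S T by (auto intro: borel_measurable_simple_function)
  have "integral\<^sup>S M g = (\<integral>\<^sup>+x. g x \<partial>M)"
    using g by (simp add: nn_integral_eq_simple_integral)
  also have "\<dots> \<le> (\<integral>\<^sup>+x. g x * indicator S x + g x * indicator T x \<partial>M)"
  proof (rule nn_integral_mono)
    \<comment> \<open>Off \<open>S \<union> T\<close> the bound \<open>le\<close> forces
      \<open>g x = 0\<close>. On \<open>S \<inter> T\<close> the right side counts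
      \<open>g x\<close> twice, so only an inequality holds.\<close>
    show "g x \<le> g x * indicator S x + g x * indicator T x" for x
      using le[of x] by (auto simp: indicator_def split: if_splits)
  qed
  also have "\<dots> = (\<integral>\<^sup>+x\<in>S. g x \<partial>M) + (\<integral>\<^sup>+x\<in>T. g x \<partial>M)"
    by (rule nn_integral_add) auto
  also have "\<dots> \<le> (\<integral>\<^sup>+x\<in>S. f x \<partial>M) + (\<integral>\<^sup>+x\<in>T. f x \<partial>M)"
  proof (intro add_mono nn_integral_mono)
    show "g x * indicator S x \<le> f x * indicator S x" "g x * indicator T x \<le> f x * indicator T x" for x
      using le[of x] by (auto simp: indicator_def split: if_splits)
  qed
  finally show "integral\<^sup>S M g \<le> (\<integral>\<^sup>+x\<in>S. f x \<partial>M) + (\<integral>\<^sup>+x\<in>T. f x \<partial>M)" .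
qed

text \<open>Carries integrals over blocks of a partition of \<open>Y\<close> back to
  \<open>M\<close>. Restriction multiplies the integrand by the indicator of \<open>Y\<close>, which
  is 1 wherever that of \<open>S\<close> is nonzero.\<close>

lemma set_nn_integral_restrict_space:
  assumes "Y \<in> sets M" and "S \<subseteq> Y"
  shows "(\<integral>\<^sup>+x\<in>S. f x \<partial>restrict_space M Y) = (\<integral>\<^sup>+x\<in>S. f x \<partial>M)"
proof -
  have "Y \<inter> space M \<in> sets M"
    using assms(1) by auto
  then have "(\<integral>\<^sup>+x\<in>S. f x \<partial>restrict_space M Y) = (\<integral>\<^sup>+x. f x * indicator S x * indicator Y x \<partial>M)"
    by (rule nn_integral_restrict_space)
  also have "\<dots> = (\<integral>\<^sup>+x\<in>S. f x \<partial>M)"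
    using assms(2) by (intro nn_integral_cong) (auto simp: indicator_def)
  finally show ?thesis .
qed

text \<open>All blocks of \<open>\<sigma>\<close> lie in \<open>Y\<close>, so the added set meets
  none of them. They are measurable in \<open>M\<close> because \<open>Y\<close> is.\<close>

lemma measurable_partition_extend:
  assumes \<sigma>: "measurable_partition (restrict_space M Y) m \<sigma>"
    and Y: "Y \<in> sets M" and k: "k \<in> {1..m}"
  shows "measurable_partition M m (\<sigma>(k := \<sigma> k \<union> (space M - Y)))"
proof -
  have sp: "space (restrict_space M Y) = Y"
    using Y sets.sets_into_space[OF Y] by (auto simp: space_restrict_space)
  have sets: "\<sigma> i \<in> sets M" if "i \<in> {1..m}" for i
    using \<sigma> that Y by (auto simp: measurable_partition_def sets_restrict_space_iff)
  have Un: "(\<Union>i\<in>{1..m}. \<sigma> i) = Y"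
    using \<sigma> by (simp add: measurable_partition_def sp)
  have "disjoint_family_on (\<sigma>(k := \<sigma> k \<union> (space M - Y))) {1..m}"
    unfolding disjoint_family_on_def
  proof (intro ballI impI)
    fix i j assume ij: "i \<in> {1..m}" "j \<in> {1..m}" "i \<noteq> j"
    then have "\<sigma> i \<inter> \<sigma> j = {}" "\<sigma> i \<subseteq> Y" "\<sigma> j \<subseteq> Y"
      using \<sigma> Un by (auto simp: measurable_partition_def disjoint_family_on_def)
    then show "(\<sigma>(k := \<sigma> k \<union> (space M - Y))) i \<inter> (\<sigma>(k := \<sigma> k \<union> (space M - Y))) j = {}"
      using ij(3) by (cases "i = k"; cases "j = k") auto
  qed
  moreover have "(\<Union>i\<in>{1..m}. (\<sigma>(k := \<sigma> k \<union> (space M - Y))) i) = (\<Union>i\<in>{1..m}. \<sigma> i) \<union> (space M - Y)"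
    using k by (auto split: if_splits)
  ultimately show ?thesis
    using Un Y sets k sets.sets_into_space[OF Y] by (auto simp: measurable_partition_def)
qed

lemma measurable_partition_trivial:
  assumes "i \<in> {1..m}"
  shows "measurable_partition M m (\<lambda>j. if j = i then space M else {})"
  using assms by (auto simp: measurable_partition_def disjoint_family_on_def)

theorem theorem2p4:
  fixes M :: "'x measure"
    and F :: "nat \<Rightarrow> 'x \<Rightarrow> 'h::chilbert_space set"
    and v :: "nat \<Rightarrow> 'x \<Rightarrow> real"
    and m n :: nat and A B D :: real and Y :: "'x set"
  assumes "separable_space (euclidean :: 'h topology)"
    and "m > 1"
    and "c_fusion_woven M m F v A B"
    and "0 < D" and "D < A"
    and "Y \<in> sets M"
    and "n \<in> {1..m}"
    and "\<And>h. (\<Sum>i\<in>{1..m} - {n}. \<integral>\<^sup>+x\<in>space M - Y.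
               ennreal ((v i x)\<^sup>2 * (norm (orth_proj (F i x) h))\<^sup>2) \<partial>M)
             \<le> ennreal (D * (norm h)\<^sup>2)"
  shows "c_fusion_woven (restrict_space M Y) m F v (A - D) B"
proof -
  let ?M = "restrict_space M Y"
  define f where "f h i x = ennreal ((v i x)\<^sup>2 * (norm (orth_proj (F i x) h))\<^sup>2)" for h i x
  note Y = \<open>Y \<in> sets M\<close>
  have AB: "0 < A" "A \<le> B"
    and frame: "\<And>i. i \<in> {1..m} \<Longrightarrow> c_fusion_frame M (F i) (v i)"
    and woven: "\<And>\<sigma> h. measurable_partition M m \<sigma> \<Longrightarrow>
      ennreal (A * (norm h)\<^sup>2) \<le> (\<Sum>i\<in>{1..m}. \<integral>\<^sup>+x\<in>\<sigma> i. f h i x \<partial>M) \<and>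
      (\<Sum>i\<in>{1..m}. \<integral>\<^sup>+x\<in>\<sigma> i. f h i x \<partial>M) \<le> ennreal (B * (norm h)\<^sup>2)"
    using assms(3) unfolding c_fusion_woven_def f_def by auto
  have small: "(\<Sum>i\<in>{1..m} - {n}. \<integral>\<^sup>+x\<in>space M - Y. f h i x \<partial>M) \<le> ennreal (D * (norm h)\<^sup>2)" for h
    using assms(8) unfolding f_def .
  \<comment> \<open>The index whose block receives \<open>space M - Y\<close>: 1 unless
    \<open>n = 1\<close>, and then 2, which is at most \<open>m\<close> since
    \<open>m > 1\<close>.\<close>
  define k :: nat where "k = (if n = 1 then 2 else 1)"
  have k: "k \<in> {1..m}" "k \<noteq> n"
    using \<open>m > 1\<close> by (auto simp: k_def)
  have sp: "space ?M = Y"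
    using Y sets.sets_into_space[OF Y] by (auto simp: space_restrict_space)
  \<comment> \<open>Used twice: for arbitrary partitions in the conclusion, and for one-block
    partitions to obtain the frame bounds of each restricted family.\<close>
  have woven_Y: "ennreal ((A - D) * (norm h)\<^sup>2) \<le> (\<Sum>i\<in>{1..m}. \<integral>\<^sup>+x\<in>\<sigma> i. f h i x \<partial>?M) \<and>
      (\<Sum>i\<in>{1..m}. \<integral>\<^sup>+x\<in>\<sigma> i. f h i x \<partial>?M) \<le> ennreal (B * (norm h)\<^sup>2)"
    if \<sigma>: "measurable_partition ?M m \<sigma>" for \<sigma> h
  proof -
    define \<tau> where "\<tau> = \<sigma>(k := \<sigma> k \<union> (space M - Y))"
    have \<tau>: "measurable_partition M m \<tau>"
      unfolding \<tau>_def by (rule measurable_partition_extend[OF \<sigma> Y k(1)])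
    have \<sigma>_sets: "\<sigma> i \<in> sets M" "\<sigma> i \<subseteq> Y" if "i \<in> {1..m}" for i
      using \<sigma> that Y by (auto simp: measurable_partition_def sets_restrict_space_iff)
    define s where "s = (\<Sum>i\<in>{1..m}. \<integral>\<^sup>+x\<in>\<sigma> i. f h i x \<partial>M)"
    have s_eq: "(\<Sum>i\<in>{1..m}. \<integral>\<^sup>+x\<in>\<sigma> i. f h i x \<partial>?M) = s"
      unfolding s_def by (intro sum.cong refl set_nn_integral_restrict_space Y \<sigma>_sets)
    \<comment> \<open>Each block of \<open>\<tau>\<close> contains that of \<open>\<sigma>\<close>,
      so the upper bound \<open>B\<close> is inherited.\<close>
    have "s \<le> (\<Sum>i\<in>{1..m}. \<integral>\<^sup>+x\<in>\<tau> i. f h i x \<partial>M)"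
      unfolding s_def
      by (intro sum_mono nn_integral_mono) (auto simp: \<tau>_def indicator_def)
    with woven[OF \<tau>, of h] have upper: "s \<le> ennreal (B * (norm h)\<^sup>2)"
      by auto
    have "ennreal (A * (norm h)\<^sup>2) \<le> (\<Sum>i\<in>{1..m}. \<integral>\<^sup>+x\<in>\<tau> i. f h i x \<partial>M)"
      using woven[OF \<tau>] by blast
    also have "\<dots> = (\<integral>\<^sup>+x\<in>\<tau> k. f h k x \<partial>M) + (\<Sum>i\<in>{1..m} - {k}. \<integral>\<^sup>+x\<in>\<tau> i. f h i x \<partial>M)"
      using k(1) by (intro sum.remove) auto
    also have "\<dots> \<le> ((\<integral>\<^sup>+x\<in>\<sigma> k. f h k x \<partial>M) + (\<integral>\<^sup>+x\<in>space M - Y. f h k x \<partial>M))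
        + (\<Sum>i\<in>{1..m} - {k}. \<integral>\<^sup>+x\<in>\<sigma> i. f h i x \<partial>M)"
    proof (rule add_mono)
      show "(\<integral>\<^sup>+x\<in>\<tau> k. f h k x \<partial>M) \<le> (\<integral>\<^sup>+x\<in>\<sigma> k. f h k x \<partial>M) + (\<integral>\<^sup>+x\<in>space M - Y. f h k x \<partial>M)"
        unfolding \<tau>_def fun_upd_same by (intro set_nn_integral_Un_le \<sigma>_sets(1)[OF k(1)] sets.compl_sets Y)
    qed (simp add: \<tau>_def)
    also have "\<dots> = s + (\<integral>\<^sup>+x\<in>space M - Y. f h k x \<partial>M)"
    proof -
      have "s = (\<integral>\<^sup>+x\<in>\<sigma> k. f h k x \<partial>M) + (\<Sum>i\<in>{1..m} - {k}. \<integral>\<^sup>+x\<in>\<sigma> i. f h i x \<partial>M)"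
        unfolding s_def using k(1) by (intro sum.remove) auto
      then show ?thesis
        by (simp only: ac_simps)
    qed
    \<comment> \<open>As \<open>k \<noteq> n\<close>, the extra integral is one of the nonnegative
      terms of the sum that \<open>small\<close> bounds.\<close>
    also have "\<dots> \<le> s + (\<Sum>i\<in>{1..m} - {n}. \<integral>\<^sup>+x\<in>space M - Y. f h i x \<partial>M)"
      using k by (intro add_left_mono member_le_sum) auto
    also have "\<dots> \<le> s + ennreal (D * (norm h)\<^sup>2)"
      by (rule add_left_mono[OF small])
    finally have "ennreal (A * (norm h)\<^sup>2) \<le> s + ennreal (D * (norm h)\<^sup>2)" .
    \<comment> \<open>Both terms on the left are finite, so the subtraction is safe even if
      \<open>s\<close> is infinite; \<open>0 < D\<close> then lets it move inside
      \<open>ennreal\<close>.\<close>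
    then have "ennreal (A * (norm h)\<^sup>2) - ennreal (D * (norm h)\<^sup>2) \<le> s"
      by (simp add: ennreal_minus_le_iff add.commute)
    then have "ennreal ((A - D) * (norm h)\<^sup>2) \<le> s"
      using \<open>0 < D\<close> by (simp add: ennreal_minus left_diff_distrib)
    with upper show ?thesis
      unfolding s_eq by blast
  qed
  have "c_fusion_frame ?M (F i) (v i)" if i: "i \<in> {1..m}" for i
  proof -
    \<comment> \<open>With all of \<open>Y\<close> in block \<open>i\<close>, the weaving sum
      collapses to the frame integral of the single family \<open>i\<close>.\<close>
    have "(\<Sum>j\<in>{1..m}. \<integral>\<^sup>+x\<in>(if j = i then space ?M else {}). f h j x \<partial>?M) = (\<integral>\<^sup>+x. f h i x \<partial>?M)" for h
    proof -
      have "(\<Sum>j\<in>{1..m}. \<integral>\<^sup>+x\<in>(if j = i then space ?M else {}). f h j x \<partial>?M)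
          = (\<Sum>j\<in>{1..m}. if j = i then \<integral>\<^sup>+x. f h i x \<partial>?M else 0)"
        by (intro sum.cong refl) (auto intro: nn_integral_cong)
      then show ?thesis
        using i by simp
    qed
    with woven_Y[OF measurable_partition_trivial[OF i]]
    have "ennreal ((A - D) * (norm h)\<^sup>2) \<le> (\<integral>\<^sup>+x. f h i x \<partial>?M) \<and>
        (\<integral>\<^sup>+x. f h i x \<partial>?M) \<le> ennreal (B * (norm h)\<^sup>2)" for h
      by metis
    then have "\<exists>A B. 0 < A \<and> A \<le> B \<and> (\<forall>h. ennreal (A * (norm h)\<^sup>2) \<le> (\<integral>\<^sup>+x. f h i x \<partial>?M) \<and>
        (\<integral>\<^sup>+x. f h i x \<partial>?M) \<le> ennreal (B * (norm h)\<^sup>2))"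
      \<comment> \<open>\<open>A - D\<close> is positive by \<open>D < A\<close>, and below
        \<open>B\<close> by \<open>A \<le> B\<close> and \<open>0 < D\<close>.\<close>
      using AB \<open>0 < D\<close> \<open>D < A\<close> by (intro exI[of _ "A - D"] exI[of _ B]) auto
    \<comment> \<open>The other clauses of a frame are pointwise or measurability conditions, which
      pass from \<open>M\<close> to the restriction.\<close>
    with frame[OF i] show ?thesis
      unfolding c_fusion_frame_def weakly_measurable_def f_def
      by (simp add: measurable_restrict_space1 space_restrict_space)
  qed
  then show ?thesis
    using woven_Y AB \<open>0 < D\<close> \<open>D < A\<close> unfolding c_fusion_woven_def f_def by auto
qed

end
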